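(* For every integer $n\ge 2$ with $n\ne 3$, $i_b(P_n)=\left\lceil\frac{2n}{5}\right\rceil$, where $P_n$ is the path of order $n$.
   Context: For a graph $G=(V,E)$, a broadcast is a function $f:V\to\{0,\dots,\operatorname{diam}(G)\}$ with $f(v)\le e_G(v)$ (eccentricity) for all $v$. Let $V^+_f=\{v: f(v)>0\}$ and $H_f(u)=\{v\in V^+_f: d_G(u,v)\le f(v)\}$. The cost is $\sigma(f)=\sum_v f(v)$. $f$ is independent if $|H_f(v)|=1$ for every $v\in V^+_f$. An independent broadcast $f$ is maximal if no independent broadcast $g\ne f$ satisfies $g\ge f$ pointwise. $i_b(G)$ is the minimum cost of a maximal independent broadcast on $G$. *)

theory Defs
  imports Graph_Theory.Graph_Theory "HOL-Library.Extended_Nat"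
begin

text \<open>
  A finite simple undirected graph is a \<^locale>\<open>pair_graph\<close>, each edge being
  represented by its two orientations.
\<close>

text \<open>Distances are extended naturals: vertices in different components are at distance
  \<^term>\<open>\<infinity> :: enat\<close>. On finite connected graphs all values below are finite and
  the suprema are maxima.\<close>

definition graph_dist :: "'a pair_pre_digraph \<Rightarrow> 'a \<Rightarrow> 'a \<Rightarrow> enat" where
  "graph_dist G u v = (INF p \<in> {p. pre_digraph.awalk (with_proj G) u p v}. enat (length p))"

definition eccentricity :: "'a pair_pre_digraph \<Rightarrow> 'a \<Rightarrow> enat" where
  "eccentricity G v = (SUP u \<in> pverts G. graph_dist G v u)"

definition graph_diam :: "'a pair_pre_digraph \<Rightarrow> enat" where
  "graph_diam G = (SUP v \<in> pverts G. eccentricity G v)"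

text \<open>A function on the vertex set is a total HOL function of which only the values on
  \<^term>\<open>pverts G\<close> matter; accordingly, functions are compared on \<^term>\<open>pverts G\<close> only.\<close>

definition broadcast :: "'a pair_pre_digraph \<Rightarrow> ('a \<Rightarrow> nat) \<Rightarrow> bool" where
  "broadcast G f \<longleftrightarrow>
     (\<forall>v \<in> pverts G. enat (f v) \<le> graph_diam G \<and> enat (f v) \<le> eccentricity G v)"

definition broadcast_verts :: "'a pair_pre_digraph \<Rightarrow> ('a \<Rightarrow> nat) \<Rightarrow> 'a set" where
  "broadcast_verts G f = {v \<in> pverts G. f v > 0}"

definition heard :: "'a pair_pre_digraph \<Rightarrow> ('a \<Rightarrow> nat) \<Rightarrow> 'a \<Rightarrow> 'a set" where
  "heard G f u = {v \<in> broadcast_verts G f. graph_dist G u v \<le> enat (f v)}"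

definition broadcast_cost :: "'a pair_pre_digraph \<Rightarrow> ('a \<Rightarrow> nat) \<Rightarrow> nat" where
  "broadcast_cost G f = (\<Sum>v \<in> pverts G. f v)"

definition independent_broadcast :: "'a pair_pre_digraph \<Rightarrow> ('a \<Rightarrow> nat) \<Rightarrow> bool" where
  "independent_broadcast G f \<longleftrightarrow>
     broadcast G f \<and> (\<forall>v \<in> broadcast_verts G f. card (heard G f v) = 1)"

definition maximal_independent_broadcast :: "'a pair_pre_digraph \<Rightarrow> ('a \<Rightarrow> nat) \<Rightarrow> bool" where
  "maximal_independent_broadcast G f \<longleftrightarrow>
     independent_broadcast G f \<and>
     \<not> (\<exists>g. independent_broadcast G g \<and> (\<exists>v \<in> pverts G. g v \<noteq> f v) \<and>
           (\<forall>v \<in> pverts G. f v \<le> g v))"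

definition i_b :: "'a pair_pre_digraph \<Rightarrow> nat" where
  "i_b G = (LEAST k. \<exists>f. maximal_independent_broadcast G f \<and> broadcast_cost G f = k)"

definition path_graph :: "nat \<Rightarrow> nat pair_pre_digraph" where
  "path_graph n = \<lparr> pverts = {1..n},
     parcs = {(i, j). i \<in> {1..n} \<and> j \<in> {1..n} \<and> (j = i + 1 \<or> i = j + 1)} \<rparr>"

lemma pair_graph_path_graph: "pair_graph (path_graph n)"
proof
  have "parcs (path_graph n) \<subseteq> {1..n} \<times> {1..n}"
    by (auto simp: path_graph_def)
  then show "finite (parcs (path_graph n))"
    by (rule finite_subset) simp
  show "symmetric (path_graph n)"
    by (auto simp: path_graph_def symmetric_def intro!: symI)
qed (auto simp: path_graph_def)

end

theory Submission
  imports Defs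
begin

text \<open>
  On a path, an independent broadcast \<open>f\<close> with at least two broadcasting vertices is maximal
  iff every vertex hears somebody and every broadcasting \<open>v\<close> has another broadcasting vertex
  at distance exactly \<open>f v + 1\<close>. For the lower bound, give each vertex \<open>u\<close> a charge of 2, to be
  paid by the vertices it hears: 2 by a unique one, 1 by each of several. A vertex with
  \<open>f v \<ge> 2\<close> pays at most \<open>2 (2 f v + 1) \<le> 5 f v\<close>. A vertex with \<open>f v = 1\<close> has a partner at
  distance 2, also of strength 1, and shares the vertex between them with it, so it
  pays at most \<open>2 + 2 + 1 = 5\<close>. Hence \<open>2 n \<le> 5 \<sigma>(f)\<close>. The bound is attained by broadcasts with
  values 0 and 1, whose support is built from blocks of five vertices with the
  second and the fourth broadcasting.
\<close>

section \<open>Distances in paths\<close>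

text \<open>The absolute difference on \<open>nat\<close>: subtraction truncates at 0, so at most
  one summand is nonzero.\<close>

definition nat_dist :: "nat \<Rightarrow> nat \<Rightarrow> nat" where
  "nat_dist u v = (u - v) + (v - u)"

definition path_ecc :: "nat \<Rightarrow> nat \<Rightarrow> nat" where
  "path_ecc n v = max (v - 1) (n - v)"

lemma pverts_path_graph [simp]: "pverts (path_graph n) = {1..n}"
  by (simp add: path_graph_def)

text \<open>Every arc of the path changes the vertex number by exactly one.\<close>

lemma nat_dist_le_length_awalk:
  assumes "pre_digraph.awalk (with_proj (path_graph n)) u p v"
  shows "nat_dist u v \<le> length p"
proof -
  have "set p \<subseteq> parcs (path_graph n)" "pre_digraph.cas (with_proj (path_graph n)) u p v"
    using assms by (auto simp: pre_digraph.awalk_def)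
  then show ?thesis
  proof (induction p arbitrary: u)
    case Nil
    then show ?case by (simp add: pre_digraph.cas.simps nat_dist_def)
  next
    case (Cons e p)
    obtain a b where e: "e = (a, b)" by (cases e)
    have "a = u" and cas: "pre_digraph.cas (with_proj (path_graph n)) b p v"
      using Cons.prems(2) e by (auto simp: pre_digraph.cas.simps)
    moreover have "b = a + 1 \<or> a = b + 1"
      using Cons.prems(1) e by (auto simp: path_graph_def)
    moreover have "nat_dist b v \<le> length p"
      using Cons.IH[OF _ cas] Cons.prems(1) by auto
    ultimately show ?case by (auto simp: nat_dist_def)
  qed
qed

lemma ex_awalk_path_graph:
  assumes "u \<in> {1..n}" "v \<in> {1..n}"
  shows "\<exists>p. pre_digraph.awalk (with_proj (path_graph n)) u p v \<and> length p = nat_dist u v"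
  using assms
proof (induction "nat_dist u v" arbitrary: u)
  case 0
  then have "u = v" by (simp add: nat_dist_def)
  with 0 show ?case
    by (intro exI[of _ "[]"]) (auto simp: pre_digraph.awalk_def pre_digraph.cas.simps nat_dist_def)
next
  case (Suc k)
  \<comment> \<open>The neighbour of \<open>u\<close> one step closer to \<open>v\<close>; since the
    distance is \<open>Suc k\<close>, \<open>u\<close> and \<open>v\<close> differ.\<close>
  define w where "w = (if u < v then u + 1 else u - 1)"
  have w: "k = nat_dist w v" "w \<in> {1..n}" "(u, w) \<in> parcs (path_graph n)"
    using Suc.hyps(2) Suc.prems by (auto simp: w_def nat_dist_def path_graph_def)
  obtain p where p: "pre_digraph.awalk (with_proj (path_graph n)) w p v" "length p = nat_dist w v"
    using Suc.hyps(1)[OF w(1,2) Suc.prems(2)] by blast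
  show ?case
    using p w Suc.prems Suc.hyps(2)
    by (intro exI[of _ "(u, w) # p"]) (auto simp: pre_digraph.awalk_def pre_digraph.cas.simps)
qed

lemma graph_dist_path_graph:
  assumes "u \<in> {1..n}" "v \<in> {1..n}"
  shows "graph_dist (path_graph n) u v = enat (nat_dist u v)"
  unfolding graph_dist_def
proof (rule antisym)
  obtain p where "pre_digraph.awalk (with_proj (path_graph n)) u p v" "length p = nat_dist u v"
    using ex_awalk_path_graph[OF assms] by blast
  then show "(INF p\<in>{p. pre_digraph.awalk (with_proj (path_graph n)) u p v}. enat (length p))
      \<le> enat (nat_dist u v)"
    by (metis (mono_tags, lifting) INF_lower mem_Collect_eq)
qed (auto intro!: INF_greatest nat_dist_le_length_awalk)

text \<open>The distance from \<open>v\<close> is largest at one of the two ends, \<open>1\<close>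
  or \<open>n\<close>.\<close>

lemma eccentricity_path_graph:
  assumes "v \<in> {1..n}"
  shows "eccentricity (path_graph n) v = enat (path_ecc n v)"
proof -
  have "eccentricity (path_graph n) v = (SUP u\<in>{1..n}. enat (nat_dist v u))"
    unfolding eccentricity_def using assms by (simp add: graph_dist_path_graph)
  also have "\<dots> = enat (path_ecc n v)"
  proof (rule antisym)
    show "(SUP u\<in>{1..n}. enat (nat_dist v u)) \<le> enat (path_ecc n v)"
      using assms by (intro SUP_least) (auto simp: nat_dist_def path_ecc_def)
    have "enat (nat_dist v 1) \<le> (SUP u\<in>{1..n}. enat (nat_dist v u))"
      "enat (nat_dist v n) \<le> (SUP u\<in>{1..n}. enat (nat_dist v u))"
      using assms by (intro SUP_upper; simp)+
    then show "enat (path_ecc n v) \<le> (SUP u\<in>{1..n}. enat (nat_dist v u))"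
      using assms by (auto simp: nat_dist_def path_ecc_def max_def)
  qed
  finally show ?thesis .
qed

section \<open>Independent broadcasts on paths\<close>

text \<open>The diameter is at least every eccentricity, so the bound by the eccentricity implies
  the other one.\<close>

lemma broadcast_path_graph:
  "broadcast (path_graph n) f \<longleftrightarrow> (\<forall>v\<in>{1..n}. f v \<le> path_ecc n v)"
proof -
  have "enat (f v) \<le> graph_diam (path_graph n) \<and> enat (f v) \<le> eccentricity (path_graph n) v
      \<longleftrightarrow> f v \<le> path_ecc n v" if "v \<in> {1..n}" for v
  proof -
    have "eccentricity (path_graph n) v \<le> graph_diam (path_graph n)"
      unfolding graph_diam_def using that by (intro SUP_upper) simp
    then show ?thesis
      using eccentricity_path_graph[OF that] by (metis enat_ord_simps(1) order_trans)
  qed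
  then show ?thesis by (simp add: broadcast_def)
qed

text \<open>A broadcasting vertex always hears itself, at distance 0, so cardinality 1 means that it
  hears nobody else.\<close>

lemma card_heard_path_graph:
  assumes "v \<in> {1..n}" "f v > 0"
  shows "card (heard (path_graph n) f v) = 1 \<longleftrightarrow>
    (\<forall>u\<in>{1..n}. u \<noteq> v \<longrightarrow> f u > 0 \<longrightarrow> f u < nat_dist v u)"
proof -
  have heard: "heard (path_graph n) f v = {u\<in>{1..n}. f u > 0 \<and> nat_dist v u \<le> f u}"
    using assms by (auto simp: heard_def broadcast_verts_def graph_dist_path_graph)
  then have "v \<in> heard (path_graph n) f v"
    using assms by (simp add: nat_dist_def)
  then have "card (heard (path_graph n) f v) = 1 \<longleftrightarrow> heard (path_graph n) f v = {v}"
    by (auto simp: card_1_singleton_iff)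
  also have "\<dots> \<longleftrightarrow> (\<forall>u\<in>{1..n}. u \<noteq> v \<longrightarrow> f u > 0 \<longrightarrow> f u < nat_dist v u)"
    using \<open>v \<in> heard (path_graph n) f v\<close> unfolding heard not_le[symmetric] by blast
  finally show ?thesis .
qed

lemma independent_broadcast_path_graph:
  "independent_broadcast (path_graph n) f \<longleftrightarrow>
    (\<forall>v\<in>{1..n}. f v \<le> path_ecc n v) \<and>
    (\<forall>v\<in>{1..n}. \<forall>u\<in>{1..n}. u \<noteq> v \<longrightarrow> f v > 0 \<longrightarrow> f u > 0 \<longrightarrow> f u < nat_dist v u)"
proof -
  have "(\<forall>v\<in>broadcast_verts (path_graph n) f. card (heard (path_graph n) f v) = 1) \<longleftrightarrow>
      (\<forall>v\<in>{1..n}. f v > 0 \<longrightarrow> card (heard (path_graph n) f v) = 1)"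
    unfolding broadcast_verts_def pverts_path_graph by blast
  also have "\<dots> \<longleftrightarrow>
      (\<forall>v\<in>{1..n}. f v > 0 \<longrightarrow> (\<forall>u\<in>{1..n}. u \<noteq> v \<longrightarrow> f u > 0 \<longrightarrow> f u < nat_dist v u))"
    by (intro ball_cong imp_cong refl) (rule card_heard_path_graph)
  also have "\<dots> \<longleftrightarrow>
      (\<forall>v\<in>{1..n}. \<forall>u\<in>{1..n}. u \<noteq> v \<longrightarrow> f v > 0 \<longrightarrow> f u > 0 \<longrightarrow> f u < nat_dist v u)"
    by blast
  finally show ?thesis
    unfolding independent_broadcast_def broadcast_path_graph by (rule arg_cong)
qed

section \<open>Consequences of maximality\<close>

lemma maximal_independent_broadcast_no_increment:
  assumes "maximal_independent_broadcast (path_graph n) f" "v \<in> {1..n}"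
  shows "\<not> independent_broadcast (path_graph n) (f(v := Suc (f v)))"
proof
  assume "independent_broadcast (path_graph n) (f(v := Suc (f v)))"
  moreover have "\<exists>u\<in>pverts (path_graph n). (f(v := Suc (f v))) u \<noteq> f u"
    using assms(2) by (intro bexI[of _ v]) simp_all
  moreover have "\<forall>u\<in>pverts (path_graph n). f u \<le> (f(v := Suc (f v))) u"
    by simp
  ultimately show False
    using assms(1) unfolding maximal_independent_broadcast_def by blast
qed

lemma nat_dist_commute: "nat_dist u v = nat_dist v u"
  by (simp add: nat_dist_def)

lemma nat_dist_le_path_ecc: "u \<in> {1..n} \<Longrightarrow> v \<in> {1..n} \<Longrightarrow> nat_dist u v \<le> path_ecc n v"
  by (auto simp: nat_dist_def path_ecc_def)

text \<open>The eccentricity leaves room to raise \<open>f v\<close> by one, so the raised function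
  can only fail to be independent, and pairs avoiding \<open>v\<close> are unaffected. Hence some
  \<open>u\<close> is within the raised range of \<open>v\<close>, or \<open>v\<close> is within the
  range of \<open>u\<close>.\<close>

lemma maximal_independent_broadcast_blocked:
  assumes max: "maximal_independent_broadcast (path_graph n) f"
    and v: "v \<in> {1..n}" and ecc: "f v < path_ecc n v"
  shows "\<exists>u\<in>{1..n}. u \<noteq> v \<and> f u > 0 \<and> nat_dist u v \<le> max (Suc (f v)) (f u)"
proof -
  have "independent_broadcast (path_graph n) f"
    using max by (simp add: maximal_independent_broadcast_def)
  then have ind: "\<forall>v\<in>{1..n}. f v \<le> path_ecc n v"
    "\<And>v u. \<lbrakk>v \<in> {1..n}; u \<in> {1..n}; u \<noteq> v; f v > 0; f u > 0\<rbrakk> \<Longrightarrow> f u < nat_dist v u"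
    by (auto simp: independent_broadcast_path_graph)
  show ?thesis
  proof (rule ccontr)
    assume "\<not> ?thesis"
    then have far: "max (Suc (f v)) (f u) < nat_dist u v"
      if "u \<in> {1..n}" "u \<noteq> v" "f u > 0" for u
      using that not_le by blast
    have "independent_broadcast (path_graph n) (f(v := Suc (f v)))"
      unfolding independent_broadcast_path_graph
    proof (intro conjI ballI impI)
      fix x y
      assume "x \<in> {1..n}" "y \<in> {1..n}" "y \<noteq> x" "0 < (f(v := Suc (f v))) x" "0 < (f(v := Suc (f v))) y"
      then show "(f(v := Suc (f v))) y < nat_dist x y"
        using far[of x] far[of y] ind(2)[of x y] by (auto simp: nat_dist_commute split: if_splits)
    qed (use ind ecc in auto)
    then show False
      using maximal_independent_broadcast_no_increment[OF max v] by blast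
  qed
qed

text \<open>A silent vertex has positive eccentricity because \<open>n \<ge> 2\<close>, so something
  blocks raising it to 1; the blocking \<open>v\<close> is then within
  \<open>max 1 (f v) = f v\<close>.\<close>

lemma maximal_independent_broadcast_dominating:
  assumes max: "maximal_independent_broadcast (path_graph n) f" and "n \<ge> 2" "u \<in> {1..n}"
  shows "\<exists>v\<in>{1..n}. f v > 0 \<and> nat_dist u v \<le> f v"
proof (cases "f u > 0")
  case True
  then show ?thesis using assms by (auto simp: nat_dist_def)
next
  case False
  then have "f u < path_ecc n u"
    using assms by (auto simp: path_ecc_def)
  from maximal_independent_broadcast_blocked[OF max assms(3) this]
  obtain v where "v \<in> {1..n}" "v \<noteq> u" "f v > 0" "nat_dist v u \<le> max (Suc (f u)) (f v)"
    by blast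
  with False show ?thesis by (auto simp: nat_dist_commute)
qed

text \<open>The vertex \<open>u\<close> that blocks raising \<open>f v\<close> is at distance at
  most \<open>max (Suc (f v)) (f u)\<close>, while independence makes the distance exceed both
  \<open>f v\<close> and \<open>f u\<close>. Only \<open>Suc (f v)\<close> is left.\<close>

lemma maximal_independent_broadcast_partner:
  assumes max: "maximal_independent_broadcast (path_graph n) f"
    and v: "v \<in> {1..n}" "f v > 0" and w: "w \<in> {1..n}" "f w > 0" "w \<noteq> v"
  shows "\<exists>u\<in>{1..n}. f u > 0 \<and> nat_dist u v = Suc (f v)"
proof -
  have ind: "f x < nat_dist y x \<and> f y < nat_dist y x"
    if "x \<in> {1..n}" "y \<in> {1..n}" "x \<noteq> y" "f x > 0" "f y > 0" for x y
    using max that unfolding maximal_independent_broadcast_def independent_broadcast_path_graph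
    by (metis nat_dist_commute)
  \<comment> \<open>By independence \<open>w\<close> lies beyond the range of \<open>v\<close>, so
    the eccentricity of \<open>v\<close> exceeds \<open>f v\<close>.\<close>
  have "f v < path_ecc n v"
    using ind[of v w] v w nat_dist_le_path_ecc[of w n v] by auto
  from maximal_independent_broadcast_blocked[OF max v(1) this]
  obtain u where u: "u \<in> {1..n}" "u \<noteq> v" "f u > 0" "nat_dist u v \<le> max (Suc (f v)) (f u)"
    by blast
  with ind[of v u] v have "nat_dist u v = Suc (f v)" by auto
  with u show ?thesis by blast
qed

section \<open>The lower bound\<close>

lemma card_nat_ball_le: "card {u\<in>{1..n}. nat_dist u v \<le> r} \<le> 2 * r + 1"
proof -
  have "card {u\<in>{1..n}. nat_dist u v \<le> r} \<le> card {v - r..v + r}"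
    by (intro card_mono) (auto simp: nat_dist_def)
  then show ?thesis by simp
qed

text \<open>The charging argument, for any \<open>f\<close> with the two properties it uses. A
  partner is required only for value 1, since \<open>2 * (2 * r + 1) \<le> 5 * r\<close> holds once
  \<open>r \<ge> 2\<close>.\<close>

lemma cost_ge_of_several_broadcast_verts:
  fixes f :: "nat \<Rightarrow> nat"
  assumes dom: "\<And>u. u \<in> {1..n} \<Longrightarrow> \<exists>v\<in>{1..n}. f v > 0 \<and> nat_dist u v \<le> f v"
    and partner: "\<And>v. v \<in> {1..n} \<Longrightarrow> f v = 1 \<Longrightarrow> \<exists>w\<in>{1..n}. f w > 0 \<and> nat_dist w v = 2"
  shows "2 * n \<le> 5 * (\<Sum>v\<in>{1..n}. f v)"
proof -
  define V where "V = {v\<in>{1..n}. f v > 0}"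
  define hears where "hears u v \<longleftrightarrow> nat_dist u v \<le> f v" for u v
  define pay :: "nat \<Rightarrow> nat \<Rightarrow> nat" where
    "pay u v = (if hears u v then if \<exists>w\<in>V. w \<noteq> v \<and> hears u w then 1 else 2 else 0)" for u v
  have "finite V" by (simp add: V_def)
  \<comment> \<open>A vertex that hears three or more may collect more than 2, which is harmless:
    only the lower bound enters the double counting.\<close>
  have received: "2 \<le> (\<Sum>v\<in>V. pay u v)" if u: "u \<in> {1..n}" for u
  proof -
    obtain v where v: "v \<in> V" "hears u v"
      using dom[OF u] by (auto simp: V_def hears_def)
    show ?thesis
    proof (cases "\<exists>w\<in>V. w \<noteq> v \<and> hears u w")
      case True
      then obtain w where w: "w \<in> V" "w \<noteq> v" "hears u w" by blast
      then have "pay u v = 1" "pay u w = 1"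
        using v by (auto simp: pay_def)
      then have "2 = (\<Sum>x\<in>{v, w}. pay u x)"
        using w by simp
      also have "\<dots> \<le> (\<Sum>x\<in>V. pay u x)"
        using v w \<open>finite V\<close> by (intro sum_mono2) auto
      finally show ?thesis .
    next
      case False
      then have "2 = pay u v" using v by (auto simp: pay_def)
      also have "\<dots> \<le> (\<Sum>x\<in>V. pay u x)"
        using v \<open>finite V\<close> by (intro member_le_sum) auto
      finally show ?thesis .
    qed
  qed
  have paid: "(\<Sum>u\<in>{1..n}. pay u v) \<le> 5 * f v" if v: "v \<in> V" for v
  proof -
    define B where "B = {u\<in>{1..n}. nat_dist u v \<le> f v}"
    have B: "finite B" "card B \<le> 2 * f v + 1"
      using card_nat_ball_le by (auto simp: B_def)
    have eq: "(\<Sum>u\<in>{1..n}. pay u v) = (\<Sum>u\<in>B. pay u v)"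
      by (rule sum.mono_neutral_right) (auto simp: B_def pay_def hears_def)
    have pay_le: "pay u v \<le> 2" for u by (simp add: pay_def)
    show ?thesis
    proof (cases "f v = 1")
      case True
      have "v \<in> {1..n}" using v by (simp add: V_def)
      then obtain w where w: "w \<in> {1..n}" "f w > 0" "nat_dist w v = 2"
        using partner True by blast
      \<comment> \<open>The vertex midway between \<open>v\<close> and \<open>w\<close>. It hears
        both, as \<open>f w > 0\<close> already gives \<open>w\<close> range 1, so \<open>v\<close>
        pays only 1 for it.\<close>
      define m where "m = (if v < w then v + 1 else v - 1)"
      have m: "m \<in> {1..n}" "nat_dist m v = 1" "nat_dist m w = 1" "w \<noteq> v"
        using w \<open>v \<in> {1..n}\<close> by (auto simp: m_def nat_dist_def)
      then have "m \<in> B" using True by (simp add: B_def)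
      have "pay m v = 1"
        using m w True by (auto simp: pay_def hears_def V_def)
      \<comment> \<open>The ball of radius 1 has at most three vertices; splitting off
        \<open>m\<close> gives \<open>1 + 2 + 2 = 5\<close>.\<close>
      have "(\<Sum>u\<in>B. pay u v) = pay m v + (\<Sum>u\<in>B - {m}. pay u v)"
        using \<open>m \<in> B\<close> B(1) by (rule sum.remove[rotated])
      also have "(\<Sum>u\<in>B - {m}. pay u v) \<le> card (B - {m}) * 2"
        using sum_bounded_above[of "B - {m}" "\<lambda>u. pay u v" 2] pay_le by simp
      also have "card (B - {m}) \<le> 2"
        using B True \<open>m \<in> B\<close> by simp
      finally show ?thesis using \<open>pay m v = 1\<close> True eq by simp
    next
      case False
      then have "f v \<ge> 2" using v by (simp add: V_def)
      have "(\<Sum>u\<in>B. pay u v) \<le> card B * 2"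
        using sum_bounded_above[of B "\<lambda>u. pay u v" 2] pay_le by simp
      also have "\<dots> \<le> 5 * f v" using B(2) \<open>f v \<ge> 2\<close> by linarith
      finally show ?thesis using eq by simp
    qed
  qed
  have "2 * n = (\<Sum>u\<in>{1..n}. 2)" by simp
  also have "\<dots> \<le> (\<Sum>u\<in>{1..n}. \<Sum>v\<in>V. pay u v)"
    using received by (intro sum_mono)
  also have "\<dots> = (\<Sum>v\<in>V. \<Sum>u\<in>{1..n}. pay u v)" by (rule sum.swap)
  also have "\<dots> \<le> (\<Sum>v\<in>V. 5 * f v)"
    using paid by (intro sum_mono)
  also have "\<dots> = 5 * (\<Sum>v\<in>{1..n}. f v)"
    unfolding sum_distrib_left V_def by (rule sum.mono_neutral_left) auto
  finally show ?thesis .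
qed

text \<open>With several broadcasting vertices partners exist and the charging argument applies;
  \<open>(2 * n + 4) div 5\<close> rounds \<open>2 * n / 5\<close> up. A lone broadcasting vertex
  must have its full eccentricity as value, which is at least \<open>n div 2\<close>.\<close>

lemma maximal_independent_broadcast_cost_ge:
  assumes "n \<ge> 2" "n \<noteq> 3" and max: "maximal_independent_broadcast (path_graph n) f"
  shows "(2 * n + 4) div 5 \<le> broadcast_cost (path_graph n) f"
proof -
  have cost: "broadcast_cost (path_graph n) f = (\<Sum>v\<in>{1..n}. f v)"
    by (simp add: broadcast_cost_def)
  obtain v where v: "v \<in> {1..n}" "f v > 0"
    using maximal_independent_broadcast_dominating[OF max \<open>n \<ge> 2\<close>, of 1] \<open>n \<ge> 2\<close> by auto
  show ?thesis
  proof (cases "\<exists>w\<in>{1..n}. f w > 0 \<and> w \<noteq> v")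
    case True
    then obtain v' where v': "v' \<in> {1..n}" "f v' > 0" "v' \<noteq> v" by blast
    \<comment> \<open>The required second broadcasting vertex is \<open>v'\<close> if
      \<open>x = v\<close>, and \<open>v\<close> otherwise.\<close>
    have "\<exists>w\<in>{1..n}. f w > 0 \<and> nat_dist w x = 2" if "x \<in> {1..n}" "f x = 1" for x
      using maximal_independent_broadcast_partner[OF max that(1), of v]
        maximal_independent_broadcast_partner[OF max that(1), of v'] that v v'
      by (cases "x = v") (simp_all add: numeral_2_eq_2)
    with maximal_independent_broadcast_dominating[OF max \<open>n \<ge> 2\<close>]
    have "2 * n \<le> 5 * (\<Sum>v\<in>{1..n}. f v)"
      by (intro cost_ge_of_several_broadcast_verts)
    then show ?thesis unfolding cost by linarith
  next
    case False
    have "\<not> f v < path_ecc n v"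
      using maximal_independent_broadcast_blocked[OF max v(1)] False by metis
    moreover have "f v \<le> (\<Sum>v\<in>{1..n}. f v)"
      using v by (intro member_le_sum) auto
    moreover have "n \<le> 2 * path_ecc n v + 1"
      using v by (auto simp: path_ecc_def)
    \<comment> \<open>This fails at \<open>n = 3\<close>, where the sides are 2 and 1: value 1 on
      the middle vertex alone is maximal there.\<close>
    moreover have "(2 * n + 4) div 5 \<le> n div 2"
      using \<open>n \<ge> 2\<close> \<open>n \<noteq> 3\<close> by presburger
    ultimately show ?thesis unfolding cost by linarith
  qed
qed

section \<open>Optimal broadcasts\<close>

text \<open>Describes supports of maximal independent broadcasts with values 0 and 1: an independent
  dominating set, where the distance-2 condition keeps a value 1 from being raised.\<close>

definition paired_dominating_indep :: "nat \<Rightarrow> nat set \<Rightarrow> bool" where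
  "paired_dominating_indep n S \<longleftrightarrow> S \<subseteq> {1..n} \<and>
     (\<forall>u\<in>S. \<forall>v\<in>S. nat_dist u v \<noteq> 1) \<and>
     (\<forall>u\<in>{1..n} - S. \<exists>v\<in>S. nat_dist u v = 1) \<and>
     (\<forall>u\<in>S. \<exists>v\<in>S. nat_dist u v = 2)"

text \<open>Suppose an independent \<open>g\<close> dominates the indicator and exceeds it at
  \<open>v\<close>. If \<open>v\<close> is in \<open>S\<close>, then \<open>g v \<ge> 2\<close>
  reaches a member at distance 2; otherwise \<open>v\<close> is adjacent to a member of
  \<open>S\<close>, which still broadcasts under \<open>g\<close>.\<close>

lemma maximal_independent_broadcast_indicator:
  assumes "paired_dominating_indep n S"
  shows "maximal_independent_broadcast (path_graph n) (\<lambda>v. if v \<in> S then 1 else 0)"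
    (is "maximal_independent_broadcast _ ?f")
  unfolding maximal_independent_broadcast_def
proof (intro conjI notI)
  have S: "S \<subseteq> {1..n}" "\<forall>u\<in>S. \<forall>v\<in>S. nat_dist u v \<noteq> 1"
    "\<forall>u\<in>{1..n} - S. \<exists>v\<in>S. nat_dist u v = 1" "\<forall>u\<in>S. \<exists>v\<in>S. nat_dist u v = 2"
    using assms by (auto simp: paired_dominating_indep_def)
  show "independent_broadcast (path_graph n) ?f"
    unfolding independent_broadcast_path_graph
  proof (intro conjI ballI impI)
    fix v assume v: "v \<in> {1..n}"
    show "?f v \<le> path_ecc n v"
    proof (cases "v \<in> S")
      case True
      then obtain u where "u \<in> S" "nat_dist v u = 2" using S(4) by blast
      \<comment> \<open>The member at distance 2 also shows that the eccentricity admits value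
        1.\<close>
      then show ?thesis
        using nat_dist_le_path_ecc[of u n v] S(1) v by (auto simp: nat_dist_commute)
    qed simp
  next
    fix v u assume *: "u \<noteq> v" "0 < ?f v" "0 < ?f u"
    then have "u \<in> S" "v \<in> S" by (auto split: if_splits)
    then have "nat_dist v u \<noteq> 1" "nat_dist v u \<noteq> 0"
      using S(2) * by (auto simp: nat_dist_def)
    then show "?f u < nat_dist v u" by simp
  qed
  assume "\<exists>g. independent_broadcast (path_graph n) g \<and>
    (\<exists>v\<in>pverts (path_graph n). g v \<noteq> ?f v) \<and> (\<forall>v\<in>pverts (path_graph n). ?f v \<le> g v)"
  then obtain g v where g: "independent_broadcast (path_graph n) g" "\<forall>u\<in>{1..n}. ?f u \<le> g u"
    and v: "v \<in> {1..n}" "g v \<noteq> ?f v"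
    by auto
  have gS: "g u \<ge> 1" if "u \<in> S" for u
    using bspec[OF g(2), of u] S(1) that by auto
  have gv: "g v > ?f v" using bspec[OF g(2) v(1)] v(2) by (rule le_neq_implies_less[OF _ not_sym])
  have indg: "\<And>x y. \<lbrakk>x \<in> {1..n}; y \<in> {1..n}; y \<noteq> x; g x > 0; g y > 0\<rbrakk> \<Longrightarrow> g y < nat_dist x y"
    using g(1) by (auto simp: independent_broadcast_path_graph)
  have far: "g v < nat_dist u v \<and> g u < nat_dist v u" if "u \<in> S" "u \<noteq> v" for u
  proof -
    have "u \<in> {1..n}" "g u > 0" "g v > 0"
      using S(1) gS[OF that(1)] gv that(1) by auto
    then show ?thesis
      using indg[of u v] indg[of v u] v(1) that(2) by simp
  qed
  show False
  proof (cases "v \<in> S")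
    case True
    then obtain u where "u \<in> S" "nat_dist v u = 2" using S(4) by blast
    moreover from this have "u \<noteq> v" by (auto simp: nat_dist_def)
    ultimately show False
      using far[of u] gv True by (simp add: nat_dist_commute)
  next
    case False
    then obtain u where "u \<in> S" "nat_dist v u = 1" using S(3) v by blast
    then show False
      using far[of u] gS[of u] False by auto
  qed
qed

text \<open>The vertices 2 and 4 are each other's partners and dominate 1 to 5. Shifted members are
  at least 6, so they are not adjacent to either.\<close>

lemma paired_dominating_indep_prepend_block:
  assumes "paired_dominating_indep n S"
  shows "paired_dominating_indep (n + 5) ({2, 4} \<union> (\<lambda>x. x + 5) ` S)"
proof -
  have S: "S \<subseteq> {1..n}" "\<forall>u\<in>S. \<forall>v\<in>S. nat_dist u v \<noteq> 1"
    "\<And>u. u \<in> {1..n} - S \<Longrightarrow> \<exists>v\<in>S. nat_dist u v = 1"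
    "\<And>u. u \<in> S \<Longrightarrow> \<exists>v\<in>S. nat_dist u v = 2"
    using assms by (auto simp: paired_dominating_indep_def)
  have shift [simp]: "nat_dist (u + 5) (v + 5) = nat_dist u v" for u v
    by (simp add: nat_dist_def)
  let ?T = "{2, 4} \<union> (\<lambda>x. x + 5) ` S"
  have far: "nat_dist 2 (v + 5) \<noteq> 1" "nat_dist 4 (v + 5) \<noteq> 1"
    "nat_dist (v + 5) 2 \<noteq> 1" "nat_dist (v + 5) 4 \<noteq> 1" if "v \<in> S" for v
    using S(1) that by (auto simp: nat_dist_def)
  have "\<exists>v\<in>?T. nat_dist u v = 1" if u: "u \<in> {1..n + 5} - ?T" for u
  proof (cases "u \<le> 5")
    case True
    then have "nat_dist u 2 = 1 \<or> nat_dist u 4 = 1"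
      using u by (auto simp: nat_dist_def)
    then show ?thesis by auto
  next
    case False
    then obtain x where x: "u = x + 5" "x \<ge> 1"
      by (metis Suc_leI add.commute le_add_diff_inverse less_imp_le not_le zero_less_diff One_nat_def)
    then have "x \<in> {1..n} - S" using u by auto
    then show ?thesis using S(3) x by auto
  qed
  moreover have "\<exists>v\<in>?T. nat_dist u v = 2" if u: "u \<in> ?T" for u
  proof -
    have "nat_dist 2 4 = 2" "nat_dist 4 2 = 2" by (simp_all add: nat_dist_def)
    then show ?thesis using u S(4) by fastforce
  qed
  moreover have "\<forall>u\<in>?T. \<forall>v\<in>?T. nat_dist u v \<noteq> 1"
    using S(2) far by (auto simp: nat_dist_def)
  moreover have "?T \<subseteq> {1..n + 5}" using S(1) by auto
  ultimately show ?thesis unfolding paired_dominating_indep_def by blast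
qed

text \<open>One set for each residue modulo 5, of the sizes 2, 2, 3, 3, 4 prescribed by
  \<open>(2 * n + 4) div 5\<close>.\<close>

lemma paired_dominating_indep_base:
  "paired_dominating_indep 4 {2, 4}" "paired_dominating_indep 5 {2, 4}"
  "paired_dominating_indep 6 {2, 4, 6}" "paired_dominating_indep 7 {2, 4, 6}"
  "paired_dominating_indep 8 {2, 4, 6, 8}"
proof -
  have *: "{1..4} = {1, 2, 3, 4::nat}" "{1..5} = {1, 2, 3, 4, 5::nat}"
    "{1..6} = {1, 2, 3, 4, 5, 6::nat}" "{1..7} = {1, 2, 3, 4, 5, 6, 7::nat}"
    "{1..8} = {1, 2, 3, 4, 5, 6, 7, 8::nat}"
    by (simp_all add: set_eq_iff) presburger+
  show "paired_dominating_indep 4 {2, 4}" "paired_dominating_indep 5 {2, 4}"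
    "paired_dominating_indep 6 {2, 4, 6}" "paired_dominating_indep 7 {2, 4, 6}"
    "paired_dominating_indep 8 {2, 4, 6, 8}"
    unfolding paired_dominating_indep_def * by (simp_all add: nat_dist_def insert_Diff_if)
qed

lemma ex_paired_dominating_indep:
  assumes "n \<ge> 4"
  shows "\<exists>S. paired_dominating_indep n S \<and> card S = (2 * n + 4) div 5"
  using assms
proof (induction n rule: less_induct)
  case (less n)
  show ?case
  \<comment> \<open>From 9 on, \<open>n - 5\<close> is still at least 4; the base cases cover 4 to
    8.\<close>
  proof (cases "n \<ge> 9")
    case True
    then obtain S where S: "paired_dominating_indep (n - 5) S" "card S = (2 * (n - 5) + 4) div 5"
      using less.IH[of "n - 5"] by force
    have sub: "S \<subseteq> {1..n - 5}" using S(1) by (simp add: paired_dominating_indep_def)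
    let ?T = "{2, 4} \<union> (\<lambda>x. x + 5) ` S"
    have "card ?T = card {2, 4::nat} + card ((\<lambda>x. x + 5) ` S)"
      using sub by (intro card_Un_disjoint) (auto intro: finite_subset)
    also have "card ((\<lambda>x. x + 5) ` S) = card S"
      by (intro card_image) simp
    \<comment> \<open>Five more vertices add 10 to the numerator, hence 2 to the quotient, matching
      the two new members.\<close>
    finally have "card ?T = (2 * n + 4) div 5"
      using S(2) True by simp
    moreover have "paired_dominating_indep n ?T"
      using paired_dominating_indep_prepend_block[OF S(1)] True by simp
    ultimately show ?thesis by blast
  next
    case False
    then consider "n = 4" | "n = 5" | "n = 6" | "n = 7" | "n = 8"
      using less.prems by linarith
    then show ?thesis
    proof cases
      case 1
      then show ?thesis using paired_dominating_indep_base(1) by (intro exI[of _ "{2, 4}"]) simp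
    next
      case 2
      then show ?thesis using paired_dominating_indep_base(2) by (intro exI[of _ "{2, 4}"]) simp
    next
      case 3
      then show ?thesis using paired_dominating_indep_base(3) by (intro exI[of _ "{2, 4, 6}"]) simp
    next
      case 4
      then show ?thesis using paired_dominating_indep_base(4) by (intro exI[of _ "{2, 4, 6}"]) simp
    next
      case 5
      then show ?thesis using paired_dominating_indep_base(5) by (intro exI[of _ "{2, 4, 6, 8}"]) simp
    qed
  qed
qed

lemma ex_maximal_independent_broadcast_cost:
  assumes "n \<ge> 2" "n \<noteq> 3"
  shows "\<exists>f. maximal_independent_broadcast (path_graph n) f \<and>
    broadcast_cost (path_graph n) f = (2 * n + 4) div 5"
proof (cases "n = 2")
  case True
  \<comment> \<open>For \<open>n = 2\<close> no two vertices are at distance 2, so the block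
    construction does not apply; a lone end vertex with value 1, its eccentricity, is
    maximal.\<close>
  let ?f = "\<lambda>v::nat. if v = 1 then 1 else 0 :: nat"
  have two: "{1..2} = {1, 2::nat}" by auto
  have "maximal_independent_broadcast (path_graph 2) ?f"
    unfolding maximal_independent_broadcast_def independent_broadcast_path_graph pverts_path_graph two
    by (auto simp: nat_dist_def path_ecc_def)
  moreover have "broadcast_cost (path_graph 2) ?f = 1"
    unfolding broadcast_cost_def pverts_path_graph two by simp
  ultimately show ?thesis using True by auto
next
  case False
  then obtain S where S: "paired_dominating_indep n S" "card S = (2 * n + 4) div 5"
    using ex_paired_dominating_indep[of n] assms by auto
  have "S \<subseteq> {1..n}" using S(1) by (simp add: paired_dominating_indep_def)
  then have "broadcast_cost (path_graph n) (\<lambda>v. if v \<in> S then 1 else 0) = card S"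
    by (simp add: broadcast_cost_def sum.If_cases inf.absorb2)
  with maximal_independent_broadcast_indicator[OF S(1)] S(2) show ?thesis by metis
qed

theorem theorem3p7:
  fixes n :: nat
  assumes "n \<ge> 2" and "n \<noteq> 3"
  shows "int (i_b (path_graph n)) = \<lceil>2 * real n / 5\<rceil>"
proof -
  have "i_b (path_graph n) = (2 * n + 4) div 5"
    unfolding i_b_def
  proof (rule Least_equality)
    show "\<exists>f. maximal_independent_broadcast (path_graph n) f \<and>
        broadcast_cost (path_graph n) f = (2 * n + 4) div 5"
      by (rule ex_maximal_independent_broadcast_cost[OF assms])
  qed (use maximal_independent_broadcast_cost_ge[OF assms] in blast)
  \<comment> \<open>Multiplied by 5, the bounds characterising the ceiling become
    \<open>5 * k < 2 * n + 5\<close> and \<open>2 * n \<le> 5 * k\<close>, which hold for the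
    integer quotient.\<close>
  moreover have "\<lceil>2 * real n / 5\<rceil> = int ((2 * n + 4) div 5)"
  proof (rule ceiling_unique)
    define k where "k = (2 * n + 4) div 5"
    have "5 * k < 2 * n + 5" "2 * n \<le> 5 * k"
      unfolding k_def by linarith+
    then have "real (5 * k) < real (2 * n + 5)" "real (2 * n) \<le> real (5 * k)"
      by (simp_all only: of_nat_less_iff of_nat_le_iff)
    then show "real_of_int (int ((2 * n + 4) div 5)) - 1 < 2 * real n / 5"
      "2 * real n / 5 \<le> real_of_int (int ((2 * n + 4) div 5))"
      unfolding k_def[symmetric] by simp_all
  qed
  ultimately show ?thesis by simp
qed

end
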